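(* Let $d\ge3$ be an integer and $0<\alpha<d-1$. If $f_1,f_2$ are $d$-Ramanujan of order $\alpha$, then their convolution $g(k)=\sum_{j=1}^{k-1}f_1(j)f_2(k-j)$ (for positive integers $k$) is also $d$-Ramanujan of order $\alpha$.
   Context: A function $f$ on the positive integers is $d$-Ramanujan of order $\alpha>0$ if there are a polynomial $p$ and a constant $c>0$ such that $|f(k)-(d-1)^kp(k)|\le c\,k^c\alpha^k$ for all positive integers $k$. *)

theory Defs
  imports Complex_Main "HOL-Computational_Algebra.Polynomial"
begin

text \<open>
  A function on the positive integers is a total function on \<^typ>\<open>nat\<close> whose value at 0 is ignored.
  The values lie in a complete normed field, so that real-valued and complex-valued functions are
  both covered; the polynomial has coefficients in the same field. The exponent \<open>c\<close> is the same real
  constant as the factor \<open>c\<close>, hence the use of \<open>powr\<close>.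
\<close>

definition Ramanujan_of_order ::
    "nat \<Rightarrow> real \<Rightarrow> (nat \<Rightarrow> 'a :: {real_normed_field, banach}) \<Rightarrow> bool" where
  "Ramanujan_of_order d \<alpha> f \<longleftrightarrow>
     (\<exists>(p :: 'a poly) (c :: real). c > 0 \<and>
        (\<forall>k\<ge>1. norm (f k - (of_nat d - 1) ^ k * poly p (of_nat k)) \<le> c * real k powr c * \<alpha> ^ k))"

definition convolution :: "(nat \<Rightarrow> 'a :: comm_semiring_0) \<Rightarrow> (nat \<Rightarrow> 'a) \<Rightarrow> nat \<Rightarrow> 'a" where
  "convolution f g k = (\<Sum>j = 1..<k. f j * g (k - j))"

end

theory Submission
  imports Defs
begin

text \<open>
  Dividing \<open>f k\<close> by \<open>(d - 1) ^ k\<close> is compatible with convolution and turns the Ramanujan property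
  into: \<open>f\<close> is a polynomial up to an error \<open>O(k ^ M * r ^ k)\<close>, where \<open>r = \<alpha> / (d - 1) < 1\<close>.
  Such sequences are closed under multiplication by \<open>k\<close> and under partial sums, because the tails of
  the convergent series of the errors are again errors. Writing a polynomial as \<open>c + x * p x\<close> gives
  \<open>a * (c + x p) = c (a * 1) + k (a * p) - (j a) * p\<close> for the convolution, so closure under
  convolution with polynomials follows by induction; the convolution of two errors is an error.
\<close>

section \<open>Error sequences and their closure properties\<close>

text \<open>A natural exponent \<open>M\<close> independent of the factor \<open>C\<close> keeps the
  shape of the bound stable under sums and products. The passage from and to the coupled form
  \<open>c * real k powr c\<close> is made only once, in
  \<open>power_bound_iff_powr_bound\<close>.\<close>

definition geometric_decay :: "real \<Rightarrow> (nat \<Rightarrow> 'a :: real_normed_vector) \<Rightarrow> bool" where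
  "geometric_decay r a \<longleftrightarrow> (\<exists>C M. \<forall>k\<ge>1. norm (a k) \<le> C * real k ^ M * r ^ k)"

definition asymp_poly :: "real \<Rightarrow> (nat \<Rightarrow> 'a :: real_normed_field) \<Rightarrow> bool" where
  "asymp_poly r a \<longleftrightarrow> (\<exists>p. geometric_decay r (\<lambda>k. a k - poly p (of_nat k)))"

lemma geometric_decayI:
  assumes "\<And>k. k \<ge> 1 \<Longrightarrow> norm (a k) \<le> C * real k ^ M * r ^ k"
  shows "geometric_decay r a"
  using assms unfolding geometric_decay_def by blast

text \<open>The definition fixes no sign for \<open>C\<close>, but at k = 1 the bound reads
  \<open>norm (a 1) \<le> C * r\<close>, which forces \<open>C \<ge> 0\<close>. The sign is what the
  later monotonicity estimates rely on.\<close>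

lemma geometric_decayE:
  assumes "geometric_decay r a" "r > 0"
  obtains C M where "C \<ge> 0" "\<And>k. k \<ge> 1 \<Longrightarrow> norm (a k) \<le> C * real k ^ M * r ^ k"
proof -
  from assms(1) obtain C M where CM: "\<And>k. k \<ge> 1 \<Longrightarrow> norm (a k) \<le> C * real k ^ M * r ^ k"
    unfolding geometric_decay_def by blast
  have "0 \<le> C * r"
    using CM[of 1] norm_ge_zero[of "a 1"] by (simp del: norm_ge_zero)
  then have "C \<ge> 0"
    using \<open>r > 0\<close> by (simp add: zero_le_mult_iff)
  with CM show ?thesis
    using that by blast
qed

lemma geometric_decay_cong:
  assumes "\<And>k. k \<ge> 1 \<Longrightarrow> a k = b k"
  shows "geometric_decay r a \<longleftrightarrow> geometric_decay r b"
  using assms unfolding geometric_decay_def by simp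

lemma geometric_decay_add:
  assumes "geometric_decay r a" "geometric_decay r b" "r > 0"
  shows "geometric_decay r (\<lambda>k. a k + b k)"
proof -
  obtain C M where C: "C \<ge> 0" "\<And>k. k \<ge> 1 \<Longrightarrow> norm (a k) \<le> C * real k ^ M * r ^ k"
    using geometric_decayE assms by blast
  obtain D N where D: "D \<ge> 0" "\<And>k. k \<ge> 1 \<Longrightarrow> norm (b k) \<le> D * real k ^ N * r ^ k"
    using geometric_decayE assms by blast
  show ?thesis
  proof (rule geometric_decayI)
    fix k :: nat assume k: "k \<ge> 1"
    have "norm (a k + b k) \<le> C * real k ^ M * r ^ k + D * real k ^ N * r ^ k"
      using norm_triangle_ineq[of "a k" "b k"] C(2)[OF k] D(2)[OF k] by linarith
    also have "\<dots> \<le> C * real k ^ (M + N) * r ^ k + D * real k ^ (M + N) * r ^ k"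
      using C(1) D(1) k \<open>r > 0\<close>
      by (intro add_mono mult_right_mono mult_left_mono power_increasing) auto
    finally show "norm (a k + b k) \<le> (C + D) * real k ^ (M + N) * r ^ k"
      by (simp add: algebra_simps)
  qed
qed

lemma geometric_decay_cmult:
  fixes a :: "nat \<Rightarrow> 'a :: real_normed_field"
  assumes "geometric_decay r a" "r > 0"
  shows "geometric_decay r (\<lambda>k. c * a k)"
proof -
  obtain C M where C: "C \<ge> 0" "\<And>k. k \<ge> 1 \<Longrightarrow> norm (a k) \<le> C * real k ^ M * r ^ k"
    using geometric_decayE assms by blast
  show ?thesis
    using mult_left_mono[OF C(2) norm_ge_zero[of c]]
    by (intro geometric_decayI[where C = "norm c * C" and M = M]) (simp add: norm_mult mult.assoc)
qed

lemma geometric_decay_of_nat_mult: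
  fixes a :: "nat \<Rightarrow> 'a :: real_normed_field"
  assumes "geometric_decay r a" "r > 0"
  shows "geometric_decay r (\<lambda>k. of_nat k * a k)"
proof -
  obtain C M where C: "C \<ge> 0" "\<And>k. k \<ge> 1 \<Longrightarrow> norm (a k) \<le> C * real k ^ M * r ^ k"
    using geometric_decayE assms by blast
  show ?thesis
    using mult_left_mono[OF C(2) of_nat_0_le_iff]
    by (intro geometric_decayI[where C = C and M = "Suc M"]) (simp add: norm_mult algebra_simps)
qed

text \<open>The geometric factors of each summand multiply to \<open>r ^ k\<close>, and both
  arguments are at most k, so all summands share one bound. There are k - 1 of them, which raises
  the exponent of k by one.\<close>

lemma geometric_decay_convolution:
  fixes a b :: "nat \<Rightarrow> 'a :: real_normed_field"
  assumes "geometric_decay r a" "geometric_decay r b" "r > 0"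
  shows "geometric_decay r (convolution a b)"
proof -
  obtain C M where C: "C \<ge> 0" "\<And>k. k \<ge> 1 \<Longrightarrow> norm (a k) \<le> C * real k ^ M * r ^ k"
    using geometric_decayE assms by blast
  obtain D N where D: "D \<ge> 0" "\<And>k. k \<ge> 1 \<Longrightarrow> norm (b k) \<le> D * real k ^ N * r ^ k"
    using geometric_decayE assms by blast
  show ?thesis
  proof (rule geometric_decayI)
    fix k :: nat assume k: "k \<ge> 1"
    have "norm (a j * b (k - j)) \<le> C * D * real k ^ (M + N) * r ^ k" if j: "j \<in> {1..<k}" for j
    proof -
      have "norm (a j) \<le> C * real k ^ M * r ^ j"
        by (rule order.trans[OF C(2)])
          (use j C(1) \<open>r > 0\<close> in \<open>auto intro!: mult_right_mono mult_left_mono power_mono\<close>)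
      moreover have "norm (b (k - j)) \<le> D * real k ^ N * r ^ (k - j)"
        by (rule order.trans[OF D(2)])
          (use j D(1) \<open>r > 0\<close> in \<open>auto intro!: mult_right_mono mult_left_mono power_mono\<close>)
      ultimately have "norm (a j * b (k - j))
          \<le> (C * real k ^ M * r ^ j) * (D * real k ^ N * r ^ (k - j))"
        unfolding norm_mult using C(1) \<open>r > 0\<close> by (intro mult_mono) auto
      also have "\<dots> = C * D * real k ^ (M + N) * (r ^ j * r ^ (k - j))"
        by (simp add: power_add mult_ac)
      also have "r ^ j * r ^ (k - j) = r ^ k"
        using j by (simp flip: power_add)
      finally show ?thesis .
    qed
    then have "norm (convolution a b k) \<le> (\<Sum>j = 1..<k. C * D * real k ^ (M + N) * r ^ k)"
      unfolding convolution_def by (rule sum_norm_le)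
    also have "\<dots> \<le> real k * (C * D * real k ^ (M + N) * r ^ k)"
      unfolding sum_constant using C(1) D(1) \<open>r > 0\<close> by (intro mult_right_mono) auto
    finally show "norm (convolution a b k) \<le> C * D * real k ^ Suc (M + N) * r ^ k"
      by (simp add: mult_ac)
  qed
qed

section \<open>Partial sums of error sequences\<close>

text \<open>Differentiating the power series with coefficients \<open>n ^ M\<close> termwise gives
  the coefficients \<open>Suc n * Suc n ^ M\<close>, which raises \<open>M\<close> by one. Since
  this requires convergence in the whole unit ball, \<open>x\<close> is generalised in the
  induction.\<close>

lemma summable_power_times_geometric:
  fixes x :: real
  assumes "norm x < 1"
  shows "summable (\<lambda>n. real (Suc n) ^ M * x ^ n)"
  using assms
proof (induction M arbitrary: x)
  case 0
  then show ?case by (simp add: summable_geometric)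
next
  case (Suc M)
  have "summable (\<lambda>n. real (Suc n) ^ M * y ^ Suc n)" if "norm y < 1" for y :: real
    using summable_mult2[OF Suc.IH[OF that], of y] by (simp add: mult_ac)
  then have "summable (\<lambda>n. real n ^ M * y ^ n)" if "norm y < 1" for y :: real
    using summable_Suc_iff[of "\<lambda>n. real n ^ M * y ^ n"] that by simp
  then have "summable (\<lambda>n. diffs (\<lambda>n. real n ^ M) n * x ^ n)"
    using termdiff_converges[of x 1 "\<lambda>n. real n ^ M"] Suc.prems by blast
  then show ?case
    by (simp add: diffs_def)
qed

text \<open>The series of all \<open>a j\<close> converges to some \<open>L\<close>, and a partial
  sum differs from \<open>L\<close> only by a tail, which is again an error. The approximating
  polynomial is thus the constant \<open>L\<close>.\<close>

lemma geometric_decay_imp_asymp_poly_sum: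
  fixes a :: "nat \<Rightarrow> 'a :: {real_normed_field, banach}"
  assumes "geometric_decay r a" "0 < r" "r < 1"
  shows "asymp_poly r (\<lambda>k. \<Sum>j = 1..<k. a j)"
proof -
  obtain C M where C: "C \<ge> 0" "\<And>k. k \<ge> 1 \<Longrightarrow> norm (a k) \<le> C * real k ^ M * r ^ k"
    using geometric_decayE assms by blast
  define T where "T = (\<Sum>i. real (Suc i) ^ M * r ^ i)"
  have T: "summable (\<lambda>i. real (Suc i) ^ M * r ^ i)"
    using assms by (intro summable_power_times_geometric) auto
  have bound: "norm (a (i + k)) \<le> C * real k ^ M * r ^ k * (real (Suc i) ^ M * r ^ i)"
    if k: "k \<ge> 1" for i k
  proof -
    \<comment> \<open>This inequality separates i from k: the tail starting at k is then bounded by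
      \<open>C * real k ^ M * r ^ k\<close> times the fixed convergent sum \<open>T\<close>.\<close>
    have "i + k \<le> k * Suc i"
      using k by (cases k) auto
    then have "real (i + k) \<le> real k * real (Suc i)"
      by (metis of_nat_le_iff of_nat_mult)
    then have "real (i + k) ^ M \<le> (real k * real (Suc i)) ^ M"
      by (intro power_mono) auto
    then have "C * real (i + k) ^ M * r ^ (i + k)
        \<le> C * (real k * real (Suc i)) ^ M * r ^ (i + k)"
      using C(1) assms(2) by (intro mult_right_mono mult_left_mono) auto
    also have "\<dots> = C * real k ^ M * r ^ k * (real (Suc i) ^ M * r ^ i)"
      by (simp only: power_mult_distrib power_add mult_ac)
    finally show ?thesis
      using C(2)[of "i + k"] k by linarith
  qed
  have summable: "summable (\<lambda>i. norm (a (i + k)))" if "k \<ge> 1" for k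
    by (rule summable_comparison_test'[OF summable_mult[OF T], where N = 0])
      (use bound[OF that] in simp)
  define L where "L = (\<Sum>i. a (i + 1))"
  have "geometric_decay r (\<lambda>k. (\<Sum>j = 1..<k. a j) - poly [:L:] (of_nat k))"
  proof (rule geometric_decayI)
    fix k :: nat assume k: "k \<ge> 1"
    \<comment> \<open>The series is indexed from 0 but starts with \<open>a 1\<close>, so splitting
      off k - 1 terms leaves exactly the tail from \<open>a k\<close> on.\<close>
    have "L = (\<Sum>i. a (i + (k - 1) + 1)) + (\<Sum>i<k - 1. a (i + 1))"
      unfolding L_def using summable_norm_cancel[OF summable[of 1]]
      by (intro suminf_split_initial_segment) simp
    also have "(\<Sum>i<k - 1. a (i + 1)) = (\<Sum>j = 1..<k. a j)"
      using k by (intro sum.reindex_bij_witness[of _ "\<lambda>j. j - 1" Suc]) auto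
    also have "(\<Sum>i. a (i + (k - 1) + 1)) = (\<Sum>i. a (i + k))"
      using k by simp
    finally have "norm ((\<Sum>j = 1..<k. a j) - poly [:L:] (of_nat k)) = norm (\<Sum>i. a (i + k))"
      by (simp add: norm_minus_commute)
    also have "\<dots> \<le> (\<Sum>i. norm (a (i + k)))"
      using summable[OF k] by (rule summable_norm)
    also have "\<dots> \<le> (\<Sum>i. C * real k ^ M * r ^ k * (real (Suc i) ^ M * r ^ i))"
      using bound[OF k] summable[OF k] summable_mult[OF T] by (intro suminf_le) auto
    also have "\<dots> = C * real k ^ M * r ^ k * T"
      unfolding T_def using suminf_mult[OF T] by simp
    finally show "norm ((\<Sum>j = 1..<k. a j) - poly [:L:] (of_nat k)) \<le> C * T * real k ^ M * r ^ k"
      by (simp add: mult_ac)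
  qed
  then show ?thesis
    unfolding asymp_poly_def by blast
qed

section \<open>Partial sums of polynomials\<close>

text \<open>Summing \<open>(j + 1) ^ Suc m - j ^ Suc m\<close> over j < k telescopes to
  \<open>k ^ Suc m\<close>. The binomial expansion turns the same sum into a combination of the
  power sums of exponent at most m, in which the one of exponent m has the coefficient
  \<open>Suc m\<close>, nonzero in characteristic 0.\<close>

lemma power_sum_poly_exists:
  "\<exists>q :: 'a :: field_char_0 poly. \<forall>k. poly q (of_nat k) = (\<Sum>j<k. of_nat j ^ m)"
proof (induction m rule: less_induct)
  case (less m)
  then obtain Q :: "nat \<Rightarrow> 'a poly" where
    Q: "\<And>i k. i < m \<Longrightarrow> poly (Q i) (of_nat k) = (\<Sum>j<k. of_nat j ^ i)"
    by metis
  \<comment> \<open>This solves the telescoped identity for the power sum of exponent m, with the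
    polynomials \<open>Q i\<close> standing for the lower power sums.\<close>
  define q where "q = smult (1 / of_nat (Suc m))
    (monom 1 (Suc m) - (\<Sum>i<m. smult (of_nat (Suc m choose i)) (Q i)))"
  have "poly q (of_nat k) = (\<Sum>j<k. of_nat j ^ m)" for k
  proof -
    have "(of_nat k :: 'a) ^ Suc m = (\<Sum>j<k. of_nat (Suc j) ^ Suc m - of_nat j ^ Suc m)"
      by (subst sum_lessThan_telescope) simp
    also have "\<dots> = (\<Sum>j<k. \<Sum>i\<le>m. of_nat (Suc m choose i) * of_nat j ^ i)"
    proof (rule sum.cong)
      fix j
      have "(of_nat (Suc j) :: 'a) ^ Suc m = (of_nat j + 1) ^ Suc m"
        by (simp add: add.commute)
      also have "\<dots> = (\<Sum>i\<le>Suc m. of_nat (Suc m choose i) * of_nat j ^ i)"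
        by (subst binomial_ring) simp
      finally show "(of_nat (Suc j) :: 'a) ^ Suc m - of_nat j ^ Suc m
          = (\<Sum>i\<le>m. of_nat (Suc m choose i) * of_nat j ^ i)"
        by simp
    qed simp
    also have "\<dots> = (\<Sum>i\<le>m. of_nat (Suc m choose i) * (\<Sum>j<k. of_nat j ^ i))"
      by (subst sum.swap) (simp add: sum_distrib_left)
    also have "\<dots> = (\<Sum>i<m. of_nat (Suc m choose i) * (\<Sum>j<k. of_nat j ^ i))
        + of_nat (Suc m) * (\<Sum>j<k. of_nat j ^ m)"
      by (simp flip: lessThan_Suc_atMost)
    also have "(\<Sum>i<m. of_nat (Suc m choose i) * (\<Sum>j<k. of_nat j ^ i))
        = (\<Sum>i<m. of_nat (Suc m choose i) * poly (Q i) (of_nat k :: 'a))"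
      using Q by (intro sum.cong) auto
    finally have "(of_nat k :: 'a) ^ Suc m
        - (\<Sum>i<m. of_nat (Suc m choose i) * poly (Q i) (of_nat k))
        = of_nat (Suc m) * (\<Sum>j<k. of_nat j ^ m)"
      by (simp only: add_diff_cancel_left')
    then have "poly q (of_nat k) = 1 / of_nat (Suc m) * (of_nat (Suc m) * (\<Sum>j<k. of_nat j ^ m))"
      by (simp only: q_def poly_smult poly_diff poly_monom poly_sum mult_1_left)
    then show ?thesis
      by (simp del: of_nat_Suc)
  qed
  then show ?case by blast
qed

lemma poly_partial_sums_exists:
  fixes p :: "'a :: field_char_0 poly"
  shows "\<exists>q. \<forall>k\<ge>1. poly q (of_nat k) = (\<Sum>j = 1..<k. poly p (of_nat j))"
proof -
  obtain Q :: "nat \<Rightarrow> 'a poly" where Q: "\<And>m k. poly (Q m) (of_nat k) = (\<Sum>j<k. of_nat j ^ m)"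
    using power_sum_poly_exists by metis
  \<comment> \<open>The power sums start at j = 0, so the constant \<open>poly p 0\<close> removes
    that term; it is present only for \<open>k \<ge> 1\<close>.\<close>
  define q where "q = (\<Sum>m\<le>degree p. smult (coeff p m) (Q m)) - [:poly p 0:]"
  have "poly q (of_nat k) = (\<Sum>j = 1..<k. poly p (of_nat j))" if "k \<ge> 1" for k
  proof -
    have "poly q (of_nat k) = (\<Sum>m\<le>degree p. \<Sum>j<k. coeff p m * of_nat j ^ m) - poly p 0"
      by (simp add: q_def poly_sum Q sum_distrib_left)
    also have "\<dots> = (\<Sum>j<k. poly p (of_nat j)) - poly p 0"
      by (subst sum.swap) (simp add: poly_altdef)
    also have "\<dots> = (\<Sum>j = 1..<k. poly p (of_nat j))"
      using that by (simp add: lessThan_atLeast0 sum.atLeast_Suc_lessThan)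
    finally show ?thesis .
  qed
  then show ?thesis by blast
qed

section \<open>Closure properties of polynomials up to an error\<close>

lemma asymp_poly_cong:
  assumes "\<And>k. k \<ge> 1 \<Longrightarrow> a k = b k"
  shows "asymp_poly r a \<longleftrightarrow> asymp_poly r b"
proof -
  have "geometric_decay r (\<lambda>k. a k - poly p (of_nat k))
      \<longleftrightarrow> geometric_decay r (\<lambda>k. b k - poly p (of_nat k))" for p
    by (rule geometric_decay_cong) (simp add: assms)
  then show ?thesis
    unfolding asymp_poly_def by simp
qed

lemma asymp_poly_poly: "asymp_poly r (\<lambda>k. poly p (of_nat k))"
  unfolding asymp_poly_def
  by (intro exI[of _ p] geometric_decayI[where C = 0 and M = 0]) simp

lemma geometric_decay_imp_asymp_poly: "geometric_decay r a \<Longrightarrow> asymp_poly r a"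
  unfolding asymp_poly_def by (intro exI[of _ 0]) simp

lemma asymp_polyE:
  assumes "asymp_poly r a"
  obtains p e where "a = (\<lambda>k. poly p (of_nat k) + e k)" "geometric_decay r e"
proof -
  from assms obtain p where "geometric_decay r (\<lambda>k. a k - poly p (of_nat k))"
    unfolding asymp_poly_def by blast
  then show ?thesis
    by (intro that[of p "\<lambda>k. a k - poly p (of_nat k)"]) auto
qed

lemma asymp_poly_add:
  assumes "asymp_poly r a" "asymp_poly r b" "r > 0"
  shows "asymp_poly r (\<lambda>k. a k + b k)"
proof -
  obtain p e where 1: "a = (\<lambda>k. poly p (of_nat k) + e k)" "geometric_decay r e"
    using asymp_polyE assms(1) by blast
  obtain q f where 2: "b = (\<lambda>k. poly q (of_nat k) + f k)" "geometric_decay r f"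
    using asymp_polyE assms(2) by blast
  show ?thesis
    unfolding asymp_poly_def 1 2
    using geometric_decay_add[OF 1(2) 2(2) assms(3)]
    by (intro exI[of _ "p + q"]) (simp add: algebra_simps)
qed

lemma asymp_poly_cmult:
  assumes "asymp_poly r a" "r > 0"
  shows "asymp_poly r (\<lambda>k. c * a k)"
proof -
  obtain p e where 1: "a = (\<lambda>k. poly p (of_nat k) + e k)" "geometric_decay r e"
    using asymp_polyE assms(1) by blast
  show ?thesis
    unfolding asymp_poly_def 1
    using geometric_decay_cmult[OF 1(2) assms(2)]
    by (intro exI[of _ "smult c p"]) (simp add: algebra_simps)
qed

lemma asymp_poly_of_nat_mult:
  assumes "asymp_poly r a" "r > 0"
  shows "asymp_poly r (\<lambda>k. of_nat k * a k)"
proof -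
  obtain p e where 1: "a = (\<lambda>k. poly p (of_nat k) + e k)" "geometric_decay r e"
    using asymp_polyE assms(1) by blast
  show ?thesis
    unfolding asymp_poly_def 1
    using geometric_decay_of_nat_mult[OF 1(2) assms(2)]
    by (intro exI[of _ "pCons 0 p"]) (simp add: algebra_simps)
qed

lemma asymp_poly_partial_sums:
  fixes a :: "nat \<Rightarrow> 'a :: {real_normed_field, banach}"
  assumes "asymp_poly r a" "0 < r" "r < 1"
  shows "asymp_poly r (\<lambda>k. \<Sum>j = 1..<k. a j)"
proof -
  obtain p e where 1: "a = (\<lambda>k. poly p (of_nat k) + e k)" "geometric_decay r e"
    using asymp_polyE assms(1) by blast
  obtain q where q: "\<And>k. k \<ge> 1 \<Longrightarrow> poly q (of_nat k) = (\<Sum>j = 1..<k. poly p (of_nat j))"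
    using poly_partial_sums_exists by blast
  have "asymp_poly r (\<lambda>k. poly q (of_nat k) + (\<Sum>j = 1..<k. e j))"
    using 1 assms
    by (intro asymp_poly_add asymp_poly_poly geometric_decay_imp_asymp_poly_sum) auto
  then show ?thesis
    by (subst asymp_poly_cong) (auto simp: 1 q sum.distrib)
qed

section \<open>Closure under convolution\<close>

lemma convolution_commute: "convolution a b = convolution b a"
proof
  fix k
  show "convolution a b k = convolution b a k"
    unfolding convolution_def
    by (rule sum.reindex_bij_witness[of _ "\<lambda>j. k - j" "\<lambda>j. k - j"]) (auto simp: mult.commute)
qed

lemma convolution_add_right:
  "convolution a (\<lambda>k. b k + c k) k = convolution a b k + convolution a c k"
  by (simp add: convolution_def distrib_left sum.distrib)

lemma convolution_add_left:
  "convolution (\<lambda>k. a k + b k) c k = convolution a c k + convolution b c k"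
  by (simp add: convolution_def distrib_right sum.distrib)

text \<open>The sequence \<open>a\<close> is generalised in the induction on \<open>p\<close>,
  because the hypothesis is applied both to \<open>a\<close> and to
  \<open>\<lambda>j. of_nat j * a j\<close>.\<close>

lemma asymp_poly_convolution_poly:
  fixes a :: "nat \<Rightarrow> 'a :: {real_normed_field, banach}"
  assumes "asymp_poly r a" "0 < r" "r < 1"
  shows "asymp_poly r (convolution a (\<lambda>k. poly p (of_nat k)))"
  using assms(1)
proof (induction p arbitrary: a)
  case 0
  have "convolution a (\<lambda>k. poly 0 (of_nat k)) = (\<lambda>k. poly 0 (of_nat k))"
    by (simp add: convolution_def fun_eq_iff)
  then show ?case
    using asymp_poly_poly by metis
next
  case (pCons c p)
  let ?p = "\<lambda>k. poly p (of_nat k)"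
  \<comment> \<open>At the argument k - j the polynomial is c + (k - j) p(k - j), and the factor k -
    j is split into k, which leaves the sum, and j, which is absorbed into \<open>a\<close>. The
    factor -1 lets closure under sums and scalar multiples suffice.\<close>
  have "convolution a (\<lambda>k. poly (pCons c p) (of_nat k)) k
      = c * (\<Sum>j = 1..<k. a j) + (of_nat k * convolution a ?p k
        + (-1) * convolution (\<lambda>j. of_nat j * a j) ?p k)" for k
    unfolding convolution_def sum_distrib_left sum.distrib[symmetric]
    by (rule sum.cong) (auto simp: of_nat_diff algebra_simps)
  moreover have "asymp_poly r (\<lambda>k. c * (\<Sum>j = 1..<k. a j) + (of_nat k * convolution a ?p k
        + (-1) * convolution (\<lambda>j. of_nat j * a j) ?p k))"
    using pCons.prems assms(2,3)
    by (intro asymp_poly_add asymp_poly_cmult asymp_poly_of_nat_mult asymp_poly_partial_sums pCons.IH)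
  ultimately show ?case
    by presburger
qed

lemma asymp_poly_convolution:
  fixes a b :: "nat \<Rightarrow> 'a :: {real_normed_field, banach}"
  assumes "asymp_poly r a" "asymp_poly r b" "0 < r" "r < 1"
  shows "asymp_poly r (convolution a b)"
proof -
  obtain p e where 1: "a = (\<lambda>k. poly p (of_nat k) + e k)" "geometric_decay r e"
    using asymp_polyE assms(1) by blast
  obtain q f where 2: "b = (\<lambda>k. poly q (of_nat k) + f k)" "geometric_decay r f"
    using asymp_polyE assms(2) by blast
  \<comment> \<open>Only \<open>b\<close> is split in the first term, and \<open>a\<close> only
    against the error \<open>f\<close>. Two convolutions with polynomials and one of two errors
    remain; commutativity allows the polynomial to be the second argument.\<close>
  have "convolution a b = (\<lambda>k. convolution a (\<lambda>k. poly q (of_nat k)) k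
      + (convolution f (\<lambda>k. poly p (of_nat k)) k + convolution e f k))"
    unfolding convolution_commute[of f]
    by (simp add: fun_eq_iff 1(1) 2(1) convolution_add_left convolution_add_right add_ac)
  moreover have "asymp_poly r \<dots>"
    using asymp_poly_convolution_poly[OF assms(1,3,4)]
      asymp_poly_convolution_poly[OF geometric_decay_imp_asymp_poly[OF 2(2)] assms(3,4)]
      geometric_decay_imp_asymp_poly[OF geometric_decay_convolution[OF 1(2) 2(2) assms(3)]]
    by (intro asymp_poly_add assms(3))
  ultimately show ?thesis
    by simp
qed

section \<open>Translation to the Ramanujan property\<close>

text \<open>For \<open>k \<ge> 1\<close> a bound only weakens when the exponent grows, or when the
  factor does. So one \<open>c\<close> can dominate both \<open>C\<close> and \<open>M\<close>, and
  conversely a real exponent can be rounded up.\<close>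

lemma power_bound_iff_powr_bound:
  fixes g :: "nat \<Rightarrow> real"
  assumes "r > 0"
  shows "(\<exists>C M. \<forall>k\<ge>1. g k \<le> C * real k ^ M * r ^ k)
    \<longleftrightarrow> (\<exists>c>0. \<forall>k\<ge>1. g k \<le> c * real k powr c * r ^ k)"
proof
  assume "\<exists>C M. \<forall>k\<ge>1. g k \<le> C * real k ^ M * r ^ k"
  then obtain C M where *: "\<And>k. k \<ge> 1 \<Longrightarrow> g k \<le> C * real k ^ M * r ^ k"
    by blast
  \<comment> \<open>The summand 1 makes \<open>c\<close> positive even when \<open>M\<close> is 0
    and \<open>C\<close> is not positive.\<close>
  define c where "c = max C (real M) + 1"
  have "c > 0" "C \<le> c" "real M \<le> c"
    by (auto simp: c_def)
  have "g k \<le> c * real k powr c * r ^ k" if "k \<ge> 1" for k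
  proof -
    have "real k ^ M = real k powr real M"
      using that by (simp add: powr_realpow)
    also have "\<dots> \<le> real k powr c"
      using that \<open>real M \<le> c\<close> by (intro powr_mono) auto
    finally have "C * real k ^ M * r ^ k \<le> c * real k powr c * r ^ k"
      using \<open>c > 0\<close> \<open>C \<le> c\<close> assms by (intro mult_right_mono mult_mono) auto
    with *[OF that] show ?thesis
      by linarith
  qed
  with \<open>c > 0\<close> show "\<exists>c>0. \<forall>k\<ge>1. g k \<le> c * real k powr c * r ^ k"
    by blast
next
  assume "\<exists>c>0. \<forall>k\<ge>1. g k \<le> c * real k powr c * r ^ k"
  then obtain c where "c > 0" and *: "\<And>k. k \<ge> 1 \<Longrightarrow> g k \<le> c * real k powr c * r ^ k"
    by blast
  have "g k \<le> c * real k ^ nat \<lceil>c\<rceil> * r ^ k" if "k \<ge> 1" for k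
  proof -
    have "real k powr c \<le> real k powr real (nat \<lceil>c\<rceil>)"
      using that by (intro powr_mono real_nat_ceiling_ge) auto
    also have "\<dots> = real k ^ nat \<lceil>c\<rceil>"
      using that by (simp add: powr_realpow)
    finally have "c * real k powr c * r ^ k \<le> c * real k ^ nat \<lceil>c\<rceil> * r ^ k"
      using \<open>c > 0\<close> assms by (intro mult_right_mono mult_left_mono) auto
    with *[OF that] show ?thesis
      by linarith
  qed
  then show "\<exists>C M. \<forall>k\<ge>1. g k \<le> C * real k ^ M * r ^ k"
    by blast
qed

text \<open>Dividing the defining inequality by the positive number \<open>(real d - 1) ^ k\<close>
  replaces \<alpha> by \<alpha> / (d - 1) and removes the exponential factor from the main
  term.\<close>

lemma Ramanujan_of_order_iff_asymp_poly:
  fixes f :: "nat \<Rightarrow> 'a :: {real_normed_field, banach}"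
  assumes "d \<ge> 2" "\<alpha> > 0"
  shows "Ramanujan_of_order d \<alpha> f
    \<longleftrightarrow> asymp_poly (\<alpha> / (real d - 1)) (\<lambda>k. f k / (of_nat d - 1) ^ k)"
proof -
  \<comment> \<open>As the image of a natural number the base has a known norm in the field, namely
    \<open>real (d - 1)\<close>.\<close>
  have B: "(of_nat d - 1 :: 'a) = of_nat (d - 1)"
    using assms by (simp add: of_nat_diff)
  have b: "real d - 1 = real (d - 1)" "real (d - 1) > 0"
    using assms by auto
  have "norm (f k / (of_nat d - 1) ^ k - x) \<le> y * (\<alpha> / (real d - 1)) ^ k
      \<longleftrightarrow> norm (f k - (of_nat d - 1) ^ k * x) \<le> y * \<alpha> ^ k" for k x y
  proof -
    have "f k / of_nat (d - 1) ^ k - x = (f k - of_nat (d - 1) ^ k * x) / of_nat (d - 1) ^ k"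
      using b(2) by (simp add: field_simps)
    then have "norm (f k / of_nat (d - 1) ^ k - x)
        = norm (f k - of_nat (d - 1) ^ k * x) / real (d - 1) ^ k"
      by (simp only: norm_divide norm_power norm_of_nat)
    moreover have "y * (\<alpha> / real (d - 1)) ^ k = y * \<alpha> ^ k / real (d - 1) ^ k"
      by (simp add: power_divide)
    ultimately show ?thesis
      unfolding B b(1) using b(2) by (simp only: divide_le_cancel zero_less_power) auto
  qed
  then show ?thesis
    unfolding Ramanujan_of_order_def asymp_poly_def geometric_decay_def
    by (simp only: power_bound_iff_powr_bound[OF \<open>\<alpha> > 0\<close>])
qed

text \<open>The weights \<open>x ^ j\<close> and \<open>x ^ (k - j)\<close> multiply to
  \<open>x ^ k\<close>, which does not depend on j.\<close>

lemma convolution_divide_power: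
  fixes f g :: "nat \<Rightarrow> 'a :: field"
  shows "convolution (\<lambda>k. f k / x ^ k) (\<lambda>k. g k / x ^ k) k = convolution f g k / x ^ k"
  unfolding convolution_def sum_divide_distrib
  by (rule sum.cong) (auto simp flip: power_add)

theorem theorem7p2:
  fixes d :: nat and \<alpha> :: real
    and f\<^sub>1 f\<^sub>2 :: "nat \<Rightarrow> 'a :: {real_normed_field, banach}"
  assumes "d \<ge> 3" and "0 < \<alpha>" and "\<alpha> < real d - 1"
    and "Ramanujan_of_order d \<alpha> f\<^sub>1" and "Ramanujan_of_order d \<alpha> f\<^sub>2"
  shows "Ramanujan_of_order d \<alpha> (convolution f\<^sub>1 f\<^sub>2)"
proof -
  \<comment> \<open>The bound \<alpha> < d - 1 makes the normalised ratio less than 1, as the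
    convergence of the error series requires.\<close>
  have d: "d \<ge> 2" and r: "0 < \<alpha> / (real d - 1)" "\<alpha> / (real d - 1) < 1"
    using assms(1-3) by auto
  show ?thesis
    using asymp_poly_convolution[OF _ _ r, of "\<lambda>k. f\<^sub>1 k / (of_nat d - 1) ^ k"
        "\<lambda>k. f\<^sub>2 k / (of_nat d - 1) ^ k"] assms(4,5)
    unfolding Ramanujan_of_order_iff_asymp_poly[OF d assms(2)]
    by (simp add: convolution_divide_power[abs_def])
qed

end
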